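(* There exists a realtime quantum finite automaton with (two-way) write-only memory (RT-QFA-WOM) that recognizes the language $L_{rev}=\{wcw^{\mathrm r} \mid w\in\{a,b\}^*\}$ over the alphabet $\{a,b,c\}$, where $w^{\mathrm r}$ is the reverse of $w$, with negative one-sided error bound $\frac12$.
   Context: Realtime processing: for an input $w\in\Sigma^*$ (where $\Sigma$ is a finite alphabet not containing the end-markers ¢, \$), the input tape contains $\tilde w=$ ¢$w$\$. The machine reads $\tilde w$ from left to right, one symbol per step, and decides right after reading \$. Put $\tilde\Sigma=\Sigma\cup\{\text{¢},\$\}$. RT-QFA-WOM: a tuple $(Q,\Sigma,\Gamma,\Omega,\delta,q_1,Q_a)$ with finite state set $Q$, initial state $q_1$, accepting states $Q_a\subseteq Q$, finite register alphabet $\Omega$, and a finite alphabet $\Gamma$ for the write-only memory (WOM) tape, containing the blank symbol $\#$ and the empty symbol $\varepsilon$. The WOM tape is a two-way tape that is never read. In state $q$ reading $\sigma\in\tilde\Sigma$, the machine moves to $q'$, writes $\gamma\in\Gamma$ on the WOM tape square under the WOM head (writing $\varepsilon$ leaves the square unchanged), moves the WOM head in direction $d\in\{\leftarrow,\downarrow,\rightarrow\}$ (one square left, stay, one square right), and writes $\omega\in\Omega$ in the register, with amplitude $\delta(q,\sigma,q',\gamma,d,\omega)\in\mathbb C$. A configuration consists of the state, the input head position, the content of the WOM tape and the WOM head position (the register is not part of it, and is reset to a fixed initial symbol before every step). For a given input let $\mathcal C$ be the set of attainable configurations, and for $\omega\in\Omega$ let $E_\omega$ be the matrix of one-step amplitudes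 between configurations with $\omega$ written in the register. The machine must be well-formed: $\sum_{\omega}E_\omega^\dagger E_\omega=I$ for every input. The state evolves from the initial configuration (WOM tape blank) by $\rho\mapsto\sum_\omega E_\omega\rho E_\omega^\dagger$ in each step, and $f_{\mathcal M}(w)$ is the probability that, after \$ is processed, a measurement of the internal state gives a state in $Q_a$. $L$ is recognized by $\mathcal M$ with negative one-sided error bound $\epsilon\in[0,1)$ if $f_{\mathcal M}(w)=1$ for all $w\in L$ and $f_{\mathcal M}(w)\le\epsilon$ for all $w\in\Sigma^*\setminus L$. *)

theory Defs
  imports Complex_Main
begin

datatype 's tape_symbol = LeftEnd | Letter 's | RightEnd

definition input_tape :: "'s list \<Rightarrow> 's tape_symbol list" where
  "input_tape w = LeftEnd # map Letter w @ [RightEnd]"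

datatype direction = MoveLeft | Stay | MoveRight

lemma UNIV_direction: "(UNIV :: direction set) = {MoveLeft, Stay, MoveRight}"
  by (auto intro: direction.exhaust)

instance direction :: finite
  by standard (simp add: UNIV_direction)

fun displacement :: "direction \<Rightarrow> int" where
  "displacement MoveLeft = - 1"
| "displacement Stay = 0"
| "displacement MoveRight = 1"

text \<open>
  \<open>delta M q \<sigma> q' \<gamma> d \<omega>\<close> is the amplitude for moving from \<open>q\<close> to \<open>q'\<close> on reading \<open>\<sigma>\<close>,
  writing \<open>\<gamma>\<close> on the write-only memory (WOM) tape, moving the WOM head in direction \<open>d\<close>,
  and writing \<open>\<omega>\<close> in the register. The symbol in the register before a step is always the
  same and does not influence the step, so the initial register symbol is not represented.
\<close>

record ('q, 's, 'g, 'r) rt_qfa_wom =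
  states :: "'q set"
  input_alphabet :: "'s set"
  wom_alphabet :: "'g set"
  blank :: 'g
  empty_symbol :: 'g
  register_alphabet :: "'r set"
  delta :: "'q \<Rightarrow> 's tape_symbol \<Rightarrow> 'q \<Rightarrow> 'g \<Rightarrow> direction \<Rightarrow> 'r \<Rightarrow> complex"
  init :: 'q
  accepting :: "'q set"

text \<open>State, input head position, WOM tape content, WOM head position.\<close>

type_synonym ('q, 'g) configuration = "'q \<times> nat \<times> (int \<Rightarrow> 'g) \<times> int"

definition init_conf :: "('q, 's, 'g, 'r) rt_qfa_wom \<Rightarrow> ('q, 'g) configuration" where
  "init_conf M = (init M, 0, (\<lambda>_. blank M), 0)"

definition wom_write ::
  "('q, 's, 'g, 'r) rt_qfa_wom \<Rightarrow> 'g \<Rightarrow> int \<Rightarrow> (int \<Rightarrow> 'g) \<Rightarrow> (int \<Rightarrow> 'g)" where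
  "wom_write M \<gamma> h t = (if \<gamma> = empty_symbol M then t else t(h := \<gamma>))"

text \<open>
  The entry of \<open>E\<^sub>\<omega>\<close> in row \<open>c'\<close> and column \<open>c\<close>. Several pairs \<open>(\<gamma>, d)\<close> can lead from \<open>c\<close> to
  the same \<open>c'\<close> (writing the symbol already present has the effect of writing the empty
  symbol); their amplitudes add up. No step is made once the right end-marker has been read,
  so the columns of configurations with head position \<open>length (input_tape w)\<close> are zero.
\<close>

definition step_amp ::
  "('q, 's, 'g, 'r) rt_qfa_wom \<Rightarrow> 's list \<Rightarrow> 'r \<Rightarrow>
   ('q, 'g) configuration \<Rightarrow> ('q, 'g) configuration \<Rightarrow> complex" where
  "step_amp M w \<omega> c' c =
    (case c of (q, i, t, h) \<Rightarrow> case c' of (q', i', t', h') \<Rightarrow>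
      if q' \<in> states M \<and> i < length (input_tape w) \<and> i' = Suc i
      then \<Sum>(\<gamma>, d) \<in> {(\<gamma>, d). \<gamma> \<in> wom_alphabet M \<and> t' = wom_write M \<gamma> h t \<and>
                             h' = h + displacement d}.
             delta M q (input_tape w ! i) q' \<gamma> d \<omega>
      else 0)"

inductive_set attainable ::
  "('q, 's, 'g, 'r) rt_qfa_wom \<Rightarrow> 's list \<Rightarrow> ('q, 'g) configuration set"
  for M :: "('q, 's, 'g, 'r) rt_qfa_wom" and w :: "'s list" where
  initial: "init_conf M \<in> attainable M w"
| step: "c \<in> attainable M w \<Longrightarrow> \<omega> \<in> register_alphabet M \<Longrightarrow> step_amp M w \<omega> c' c \<noteq> 0 \<Longrightarrow>
    c' \<in> attainable M w"

text \<open>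
  The condition \<open>\<Sum>\<^sub>\<omega> E\<^sub>\<omega>\<^sup>\<dagger> E\<^sub>\<omega> = I\<close>, entry by entry, on those attainable configurations from
  which a step is made, that is, those in which the right end-marker has not yet been read.
\<close>

definition well_formed_on :: "('q, 's, 'g, 'r) rt_qfa_wom \<Rightarrow> 's list \<Rightarrow> bool" where
  "well_formed_on M w \<longleftrightarrow>
    (\<forall>c1 \<in> attainable M w. \<forall>c2 \<in> attainable M w.
      fst (snd c1) < length (input_tape w) \<longrightarrow> fst (snd c2) < length (input_tape w) \<longrightarrow>
      (\<Sum>\<omega> \<in> register_alphabet M. \<Sum>c \<in> attainable M w.
         cnj (step_amp M w \<omega> c c1) * step_amp M w \<omega> c c2) = (if c1 = c2 then 1 else 0))"

definition is_rt_qfa_wom :: "('q, 's, 'g, 'r) rt_qfa_wom \<Rightarrow> bool" where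
  "is_rt_qfa_wom M \<longleftrightarrow>
    finite (states M) \<and> init M \<in> states M \<and> accepting M \<subseteq> states M \<and>
    finite (input_alphabet M) \<and>
    finite (wom_alphabet M) \<and> blank M \<in> wom_alphabet M \<and> empty_symbol M \<in> wom_alphabet M \<and>
    blank M \<noteq> empty_symbol M \<and>
    finite (register_alphabet M) \<and> register_alphabet M \<noteq> {} \<and>
    (\<forall>w \<in> lists (input_alphabet M). well_formed_on M w)"

text \<open>Density matrices, indexed by the attainable configurations.\<close>

definition evolve ::
  "('q, 's, 'g, 'r) rt_qfa_wom \<Rightarrow> 's list \<Rightarrow>
   (('q, 'g) configuration \<Rightarrow> ('q, 'g) configuration \<Rightarrow> complex) \<Rightarrow>
   ('q, 'g) configuration \<Rightarrow> ('q, 'g) configuration \<Rightarrow> complex" where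
  "evolve M w \<rho> c c' =
    (\<Sum>\<omega> \<in> register_alphabet M. \<Sum>e \<in> attainable M w. \<Sum>e' \<in> attainable M w.
       step_amp M w \<omega> c e * \<rho> e e' * cnj (step_amp M w \<omega> c' e'))"

definition init_density ::
  "('q, 's, 'g, 'r) rt_qfa_wom \<Rightarrow>
   ('q, 'g) configuration \<Rightarrow> ('q, 'g) configuration \<Rightarrow> complex" where
  "init_density M c c' = (if c = init_conf M \<and> c' = init_conf M then 1 else 0)"

definition final_density ::
  "('q, 's, 'g, 'r) rt_qfa_wom \<Rightarrow> 's list \<Rightarrow>
   ('q, 'g) configuration \<Rightarrow> ('q, 'g) configuration \<Rightarrow> complex" where
  "final_density M w = (evolve M w ^^ length (input_tape w)) (init_density M)"

definition accept_prob :: "('q, 's, 'g, 'r) rt_qfa_wom \<Rightarrow> 's list \<Rightarrow> real" where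
  "accept_prob M w =
    (\<Sum>c \<in> {c \<in> attainable M w. fst c \<in> accepting M}. Re (final_density M w c c))"

definition recognizes_neg_one_sided ::
  "('q, 's, 'g, 'r) rt_qfa_wom \<Rightarrow> 's list set \<Rightarrow> real \<Rightarrow> bool" where
  "recognizes_neg_one_sided M L \<epsilon> \<longleftrightarrow>
    0 \<le> \<epsilon> \<and> \<epsilon> < 1 \<and> L \<subseteq> lists (input_alphabet M) \<and>
    (\<forall>w \<in> L. accept_prob M w = 1) \<and>
    (\<forall>w \<in> lists (input_alphabet M) - L. accept_prob M w \<le> \<epsilon>)"

datatype letter = La | Lb | Lc

definition L_rev :: "letter list set" where
  "L_rev = {w @ [Lc] @ rev w | w. w \<in> lists {La, Lb}}"

text \<open>All sums over attainable configurations above are finite:\<close>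

lemma attainable_pos_le: "c \<in> attainable M w \<Longrightarrow> fst (snd c) \<le> length (input_tape w)"
  by (induction rule: attainable.induct)
    (auto simp: init_conf_def step_amp_def split: prod.splits if_splits)

lemma finite_attainable:
  assumes "finite (states M)" and "finite (wom_alphabet M)"
  shows "finite (attainable M w)"
proof -
  define R where "R n = {c \<in> attainable M w. fst (snd c) = n}" for n
  have "finite (R n)" for n
  proof (induction n)
    case 0
    have "R 0 \<subseteq> {init_conf M}"
    proof
      fix c' assume "c' \<in> R 0"
      then have att: "c' \<in> attainable M w" and pos: "fst (snd c') = 0"
        by (auto simp: R_def)
      from att show "c' \<in> {init_conf M}"
        by cases (use pos in \<open>auto simp: step_amp_def split: prod.splits if_splits\<close>)
    qed
    then show ?case
      by (rule finite_subset) simp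
  next
    case (Suc n)
    let ?f = "\<lambda>((q, i, t, h), q', \<gamma>, d).
      (q', Suc i, wom_write M \<gamma> h t, h + displacement d)"
    let ?S = "?f ` (R n \<times> states M \<times> wom_alphabet M \<times> UNIV)"
    have "c' \<in> ?S" if "c' \<in> R (Suc n)" for c'
    proof -
      from that have att: "c' \<in> attainable M w" and pos: "fst (snd c') = Suc n"
        by (auto simp: R_def)
      from att show ?thesis
      proof cases
        case initial
        with pos show ?thesis by (simp add: init_conf_def)
      next
        case (step c \<omega>)
        obtain q i t h where c: "c = (q, i, t, h)" by (cases c) auto
        obtain q' i' t' h' where c': "c' = (q', i', t', h')" by (cases c') auto
        let ?P = "{(\<gamma>, d). \<gamma> \<in> wom_alphabet M \<and> t' = wom_write M \<gamma> h t \<and>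
                    h' = h + displacement d}"
        from step(3) have q': "q' \<in> states M" and i': "i' = Suc i"
          and "(\<Sum>(\<gamma>, d) \<in> ?P. delta M q (input_tape w ! i) q' \<gamma> d \<omega>) \<noteq> 0"
          by (auto simp: c c' step_amp_def split: if_splits)
        from this(3) have "?P \<noteq> {}"
          by (metis sum.empty)
        then obtain \<gamma> d where "\<gamma> \<in> wom_alphabet M" "t' = wom_write M \<gamma> h t"
          "h' = h + displacement d"
          by auto
        moreover have "c \<in> R n"
          using step(1) pos i' by (simp add: R_def c c')
        ultimately have "c' = ?f (c, q', \<gamma>, d)"
          and "(c, q', \<gamma>, d) \<in> R n \<times> states M \<times> wom_alphabet M \<times> UNIV"
          using q' i' by (auto simp: c c')
        then show ?thesis by (rule image_eqI)
      qed
    qed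
    then have "R (Suc n) \<subseteq> ?S" by blast
    moreover have "finite ?S"
      using Suc assms by (intro finite_imageI finite_cartesian_product) auto
    ultimately show ?case by (rule finite_subset)
  qed
  moreover have "attainable M w \<subseteq> (\<Union>n \<le> length (input_tape w). R n)"
    using attainable_pos_le by (fastforce simp: R_def)
  ultimately show ?thesis
    by (meson finite_UN_I finite_atMost finite_subset)
qed

end

theory Submission
  imports Defs
begin

text \<open>
  Reading the left end-marker, the machine splits into two deterministic paths of amplitude
  \<open>1 / sqrt 2\<close>. Before the first \<open>Lc\<close> both paths move the WOM head to the right, but only the
  first one writes down the input; afterwards both move it to the left, but only the second
  one writes. On an input \<open>u @ Lc # v\<close> the head positions always coincide, and the tapes
  coincide exactly if \<open>v = rev u\<close>. A Hadamard step on the right end-marker then makes the two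
  paths interfere: the amplitude of rejection cancels if the memories agree; if they differ
  there is no interference and the input is accepted with probability \<open>1 / 2\<close>.
\<close>

section \<open>The two-path machine and its one-step amplitudes\<close>

definition half_amp :: complex where
  "half_amp = complex_of_real (1 / sqrt 2)"

lemma half_amp_simps [simp]:
  "cnj half_amp = half_amp" "half_amp * half_amp = 1 / 2" "half_amp \<noteq> 0"
  by (simp_all add: half_amp_def flip: of_real_mult)

text \<open>Symbol 1 is the empty symbol, so a path that would record \<open>Lc\<close> writes nothing.\<close>

fun code :: "letter \<Rightarrow> nat" where
  "code La = 2"
| "code Lb = 3"
| "code Lc = 1"

text \<open>
  State 0 is initial. The paths are in states 1 and 2 before the first \<open>Lc\<close>, in 3 and 4 until
  the second, and in 5 and 6 after it. State 7 accepts and 8 rejects.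
\<close>

fun next_state :: "nat \<Rightarrow> letter \<Rightarrow> nat" where
  "next_state q x = (if x = Lc \<and> q \<le> 4 then q + 2 else q)"

text \<open>Orthonormality of the columns matters on attainable configurations only. The left
  end-marker is read in state 0 alone, so the clause for \<open>LeftEnd\<close> can ignore
  \<open>q\<close>.\<close>

fun amp :: "nat \<Rightarrow> letter tape_symbol \<Rightarrow> nat \<Rightarrow> complex" where
  "amp q LeftEnd q' = (if q' \<in> {1, 2} then half_amp else 0)"
| "amp q (Letter x) q' = (if q' = next_state q x then 1 else 0)"
| "amp q RightEnd q' =
    (if q \<in> {3, 4} then
       if q' = 7 then half_amp
       else if q' = 8 then (if q = 3 then half_amp else - half_amp)
       else 0
     else if q' = q then 1 else 0)"

text \<open>The head turns around while the first \<open>Lc\<close> is read: the move to the left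
  brings it from the blank square after the prefix back onto the square of the last letter.\<close>

fun act :: "nat \<Rightarrow> letter tape_symbol \<Rightarrow> nat \<times> direction" where
  "act q (Letter x) =
    (if q = 1 then (code x, if x = Lc then MoveLeft else MoveRight)
     else if q = 2 then (1, if x = Lc then MoveLeft else MoveRight)
     else if q = 3 then (1, MoveLeft)
     else if q = 4 then (code x, MoveLeft)
     else (1, Stay))"
| "act q _ = (1, Stay)"

text \<open>A single register symbol means a single operation element, so pure states stay
  pure.\<close>

definition rev_machine :: "(nat, letter, nat, nat) rt_qfa_wom" where
  "rev_machine = \<lparr>states = {..8}, input_alphabet = {La, Lb, Lc}, wom_alphabet = {..3},
     blank = 0, empty_symbol = 1, register_alphabet = {0},
     delta = (\<lambda>q \<sigma> q' \<gamma> d \<omega>. if (\<gamma>, d) = act q \<sigma> then amp q \<sigma> q' else 0),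
     init = 0, accepting = {7}\<rparr>"

lemma rev_machine_simps [simp]:
  "states rev_machine = {..8}" "input_alphabet rev_machine = {La, Lb, Lc}"
  "wom_alphabet rev_machine = {..3}" "blank rev_machine = 0" "empty_symbol rev_machine = 1"
  "register_alphabet rev_machine = {0}" "init rev_machine = 0" "accepting rev_machine = {7}"
  "delta rev_machine q \<sigma> q' \<gamma> d \<omega> = (if (\<gamma>, d) = act q \<sigma> then amp q \<sigma> q' else 0)"
  by (simp_all add: rev_machine_def)

definition update ::
  "nat \<Rightarrow> letter tape_symbol \<Rightarrow> (int \<Rightarrow> nat) \<times> int \<Rightarrow> (int \<Rightarrow> nat) \<times> int" where
  "update q \<sigma> = (\<lambda>(t, h). case act q \<sigma> of (\<gamma>, d) \<Rightarrow>
     (if \<gamma> = 1 then t else t(h := \<gamma>), h + displacement d))"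

lemma update_ends [simp]: "update q LeftEnd m = m" "update q RightEnd m = m"
  by (simp_all add: update_def split: prod.splits)

lemma fst_act_le: "fst (act q \<sigma>) \<le> 3"
proof -
  have "code x \<le> 3" for x by (cases x) simp_all
  then show ?thesis by (cases \<sigma>) auto
qed

text \<open>State and symbol fix the WOM action, so among all pairs \<open>(\<gamma>, d)\<close>
  with the same effect at most \<open>act q \<sigma>\<close> contributes to the sum.\<close>

lemma step_amp_rev_machine:
  "step_amp rev_machine w \<omega> (q', i', m') (q, i, m) =
    (if q' \<le> 8 \<and> i < length (input_tape w) \<and> i' = Suc i \<and> m' = update q (input_tape w ! i) m
     then amp q (input_tape w ! i) q' else 0)"
proof -
  obtain t h where m: "m = (t, h)" by (cases m)
  obtain t' h' where m': "m' = (t', h')" by (cases m')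
  let ?\<sigma> = "input_tape w ! i"
  let ?a = "amp q ?\<sigma> q'"
  define P where "P = {(\<gamma>, d). \<gamma> \<in> {..3::nat} \<and> t' = wom_write rev_machine \<gamma> h t \<and>
                             h' = h + displacement d}"
  have "P \<subseteq> {..3} \<times> UNIV" by (auto simp: P_def)
  then have fin: "finite P" by (rule finite_subset) simp
  have "(\<Sum>(\<gamma>, d)\<in>P. if (\<gamma>, d) = act q ?\<sigma> then ?a else 0)
      = (\<Sum>x\<in>P. if x = act q ?\<sigma> then ?a else 0)"
    by (rule sum.cong) auto
  also have "\<dots> = (if act q ?\<sigma> \<in> P then ?a else 0)"
    using fin by simp
  also have "act q ?\<sigma> \<in> P \<longleftrightarrow> m' = update q ?\<sigma> m"
    using fst_act_le[of q ?\<sigma>]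
    by (cases "act q ?\<sigma>") (simp add: P_def m m' update_def wom_write_def)
  finally show ?thesis
    by (simp add: step_amp_def m m' P_def)
qed

section \<open>The two deterministic paths and the attainable configurations\<close>

fun run_step :: "nat \<times> (int \<Rightarrow> nat) \<times> int \<Rightarrow> letter \<Rightarrow> nat \<times> (int \<Rightarrow> nat) \<times> int" where
  "run_step (q, m) x = (next_state q x, update q (Letter x) m)"

definition run :: "nat \<Rightarrow> letter list \<Rightarrow> nat \<times> (int \<Rightarrow> nat) \<times> int" where
  "run j xs = foldl run_step (j, \<lambda>_. 0, 0) xs"

lemma run_snoc: "run j (xs @ [x]) = run_step (run j xs) x"
  by (simp add: run_def)

text \<open>The head position is \<open>Suc k\<close> because the left end-marker precedes the
  \<open>k\<close> letters read.\<close>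

definition path_conf :: "letter list \<Rightarrow> nat \<Rightarrow> nat \<Rightarrow> (nat, nat) configuration" where
  "path_conf w j k = (case run j (take k w) of (q, m) \<Rightarrow> (q, Suc k, m))"

text \<open>The parity of the state identifies the path, so the two paths never meet on
  letters.\<close>

lemma fst_run:
  assumes "j \<in> {1, 2}"
  shows "fst (run j xs) \<in> {j, j + 2, j + 4}"
proof (induction xs rule: rev_induct)
  case Nil
  then show ?case by (simp add: run_def)
next
  case (snoc x xs)
  then show ?case using assms
    by (cases "run j xs") (auto simp: run_snoc)
qed

text \<open>Both paths advance at the same occurrences of \<open>Lc\<close>, so states 3 and 4 enter
  the Hadamard step together.\<close>

lemma fst_run_Suc: "fst (run 2 xs) = Suc (fst (run 1 xs))"
proof (induction xs rule: rev_induct)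
  case Nil
  then show ?case by (simp add: run_def)
next
  case (snoc x xs)
  then show ?case using fst_run[of 1 xs] fst_run[of 2 xs]
    by (cases "run 1 xs"; cases "run 2 xs") (auto simp: run_snoc)
qed

lemma length_input_tape [simp]: "length (input_tape w) = Suc (Suc (length w))"
  by (simp add: input_tape_def)

lemma input_tape_nth:
  "input_tape w ! 0 = LeftEnd"
  "k < length w \<Longrightarrow> input_tape w ! Suc k = Letter (w ! k)"
  "input_tape w ! Suc (length w) = RightEnd"
  by (simp_all add: input_tape_def nth_append)

lemma init_conf_rev_machine: "init_conf rev_machine = (0, 0, \<lambda>_. 0, 0)"
  by (simp add: init_conf_def)

lemma step_amp_init:
  "step_amp rev_machine w \<omega> c (init_conf rev_machine) =
    half_amp * of_bool (c = path_conf w 1 0) + half_amp * of_bool (c = path_conf w 2 0)"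
  by (cases c) (auto simp: init_conf_rev_machine step_amp_rev_machine input_tape_nth
      path_conf_def run_def)

lemma step_amp_path_conf:
  assumes "k < length w" "j \<in> {1, 2}"
  shows "step_amp rev_machine w \<omega> c (path_conf w j k) = of_bool (c = path_conf w j (Suc k))"
proof -
  obtain q m where r: "run j (take k w) = (q, m)" by (meson surj_pair)
  have "next_state q (w ! k) \<le> 8"
    using fst_run[OF assms(2), of "take k w"] assms(2) r by auto
  then show ?thesis
    using assms(1) r
    by (cases c) (auto simp: path_conf_def step_amp_rev_machine input_tape_nth
        take_Suc_conv_app_nth run_snoc simp del: next_state.simps)
qed

lemma path_conf_attainable:
  assumes "j \<in> {1, 2}" "k \<le> length w"
  shows "path_conf w j k \<in> attainable rev_machine w"
  using assms(2)
proof (induction k)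
  case 0
  show ?case
    by (rule attainable.step[OF attainable.initial, where \<omega> = 0])
      (use assms(1) in \<open>auto simp: step_amp_init\<close>)
next
  case (Suc k)
  show ?case
    by (rule attainable.step[where c = "path_conf w j k" and \<omega> = 0])
      (use Suc assms(1) in \<open>auto simp: step_amp_path_conf\<close>)
qed

text \<open>Each path configuration has one successor until the right end-marker is read. The bound
  on the head position excludes the configurations after that, which include those in states 7 and
  8.\<close>

lemma attainable_cases:
  assumes "c \<in> attainable rev_machine w" "fst (snd c) < length (input_tape w)"
  obtains "c = init_conf rev_machine"
  | j k where "j \<in> {1, 2}" "k \<le> length w" "c = path_conf w j k"
proof -
  have "c = init_conf rev_machine \<or> (\<exists>j k. j \<in> {1, 2} \<and> k \<le> length w \<and> c = path_conf w j k)"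
    using assms
  proof (induction rule: attainable.induct)
    case initial
    then show ?case by simp
  next
    case (step c \<omega> c')
    \<comment> \<open>The induction hypothesis for \<open>c\<close> has the head bound as a premise,
      which must be carried back from \<open>c'\<close>.\<close>
    have pos: "fst (snd c') = Suc (fst (snd c))"
      using step.hyps(3) by (cases c; cases c') (auto simp: step_amp_rev_machine split: if_splits)
    with step consider "c = init_conf rev_machine"
      | j k where "j \<in> {1, 2}" "k \<le> length w" "c = path_conf w j k"
      by auto
    then show ?case
    proof cases
      case 1
      have "c' = path_conf w 1 0 \<or> c' = path_conf w 2 0"
        using step.hyps(3) unfolding 1 step_amp_init by (rule contrapos_np) simp
      then show ?thesis by blast
    next
      case 2
      have "fst (snd c) = Suc k" by (simp add: 2 path_conf_def split: prod.splits)
      with pos step.prems have "k < length w" by simp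
      then have "c' = path_conf w j (Suc k)"
        using step.hyps(3) 2 by (simp add: step_amp_path_conf)
      then show ?thesis using 2(1) \<open>k < length w\<close> Suc_leI by blast
    qed
  qed
  then show ?thesis using that by blast
qed

section \<open>Well-formedness\<close>

text \<open>All successors of a configuration share head position and memory and differ in the state
  only. This reduces the inner product of two columns of the step matrix to one of columns of
  \<open>amp\<close>.\<close>

lemma sum_step_amp:
  assumes "(q1, i, m1) \<in> attainable rev_machine w" "i < length (input_tape w)"
  defines "\<sigma> \<equiv> input_tape w ! i"
  shows "(\<Sum>c\<in>attainable rev_machine w. cnj (step_amp rev_machine w 0 c (q1, i, m1)) *
            step_amp rev_machine w 0 c (q2, i, m2)) =
    (if update q1 \<sigma> m1 = update q2 \<sigma> m2
     then \<Sum>q\<le>8. cnj (amp q1 \<sigma> q) * amp q2 \<sigma> q else 0)"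
proof -
  let ?A = "attainable rev_machine w"
  let ?f = "\<lambda>c. cnj (step_amp rev_machine w 0 c (q1, i, m1)) *
            step_amp rev_machine w 0 c (q2, i, m2)"
  let ?g = "\<lambda>q. (q, Suc i, update q1 \<sigma> m1)"
  have fin: "finite ?A" by (rule finite_attainable) simp_all
  have "sum ?f ?A = sum ?f (?A \<inter> ?g ` {..8})"
  proof (rule sum.mono_neutral_right[OF fin])
    show "\<forall>c\<in>?A - ?A \<inter> ?g ` {..8}. ?f c = 0"
    proof
      fix c assume "c \<in> ?A - ?A \<inter> ?g ` {..8}"
      then show "?f c = 0"
        by (cases c) (auto simp: step_amp_rev_machine \<sigma>_def)
    qed
  qed simp
  \<comment> \<open>An unattainable target contributes nothing: a nonzero amplitude from the first
    configuration would make it attainable.\<close>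
  also have "\<dots> = sum ?f (?g ` {..8})"
  proof (rule sum.mono_neutral_left)
    show "\<forall>c\<in>?g ` {..8} - ?A \<inter> ?g ` {..8}. ?f c = 0"
      using attainable.step[OF assms(1), of 0] by auto
  qed auto
  also have "\<dots> = (\<Sum>q\<le>8. ?f (?g q))"
    by (subst sum.reindex) (auto simp: inj_on_def)
  also have "\<dots> = (\<Sum>q\<le>8. if update q1 \<sigma> m1 = update q2 \<sigma> m2
      then cnj (amp q1 \<sigma> q) * amp q2 \<sigma> q else 0)"
    by (rule sum.cong) (use assms(2) in \<open>auto simp: step_amp_rev_machine \<sigma>_def\<close>)
  finally show ?thesis by auto
qed

text \<open>The step is the identity on 1, 2, 5, 6 and a Hadamard matrix from 3, 4 to 7, 8, and the
  targets of these two pieces are disjoint.\<close>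

lemma amp_columns_RightEnd:
  assumes "q1 \<in> {1, 2, 3, 4, 5, 6}" "q2 \<in> {1, 2, 3, 4, 5, 6}"
  shows "(\<Sum>q\<le>8. cnj (amp q1 RightEnd q) * amp q2 RightEnd q) = of_bool (q1 = q2)"
proof -
  let ?f = "\<lambda>q. cnj (amp q1 RightEnd q) * amp q2 RightEnd q"
  have "{..8::nat} = insert 8 (insert 7 {..6})" by auto
  then have "sum ?f {..8} = sum ?f {..6} + ?f 7 + ?f 8"
    by (simp del: amp.simps)
  also have "sum ?f {..6} =
      (\<Sum>q\<le>6. if q = q1 then of_bool (q1 = q2 \<and> q1 \<notin> {3, 4}) else 0)"
    by (rule sum.cong) auto
  also have "q1 \<le> 6" using assms(1) by auto
  then have "(\<Sum>q\<le>6. if q = q1 then of_bool (q1 = q2 \<and> q1 \<notin> {3, 4}) else (0::complex)) =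
      of_bool (q1 = q2 \<and> q1 \<notin> {3, 4})"
    by simp
  also have "of_bool (q1 = q2 \<and> q1 \<notin> {3, 4}) + ?f 7 + ?f 8 = of_bool (q1 = q2)"
    using assms by (elim insertE emptyE; simp)
  finally show ?thesis .
qed

text \<open>\<open>next_state\<close> preserves parity but is not injective: on \<open>Lc\<close>
  both 3 and 5 go to 5. The last hypothesis, valid for states taken at one input position, rules out
  such collisions within a path.\<close>

lemma amp_columns:
  assumes "j1 \<in> {1, 2}" "j2 \<in> {1, 2}" "q1 \<in> {j1, j1 + 2, j1 + 4}" "q2 \<in> {j2, j2 + 2, j2 + 4}"
    and "\<sigma> \<noteq> LeftEnd" "j1 = j2 \<Longrightarrow> q1 = q2"
  shows "(\<Sum>q\<le>8. cnj (amp q1 \<sigma> q) * amp q2 \<sigma> q) = of_bool (j1 = j2)"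
proof -
  have iff: "q1 = q2 \<longleftrightarrow> j1 = j2"
  proof
    show "q1 = q2 \<Longrightarrow> j1 = j2" using assms(1-4) by auto
  qed (rule assms(6))
  show ?thesis
  proof (cases \<sigma>)
    case (Letter x)
    have "next_state q1 x \<le> 8" using assms(1,3) by auto
    moreover have "(\<Sum>q\<le>8. cnj (amp q1 \<sigma> q) * amp q2 \<sigma> q) =
        (\<Sum>q\<le>8. if q = next_state q1 x then of_bool (next_state q1 x = next_state q2 x) else 0)"
      by (rule sum.cong) (auto simp: Letter simp del: next_state.simps)
    moreover have "next_state q1 x = next_state q2 x \<longleftrightarrow> j1 = j2"
    proof
      show "next_state q1 x = next_state q2 x \<Longrightarrow> j1 = j2"
        using assms(1-4) by (auto split: if_splits)
    qed (simp add: assms(6))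
    ultimately show ?thesis by simp
  next
    case RightEnd
    have q: "q1 \<in> {1, 2, 3, 4, 5, 6}" "q2 \<in> {1, 2, 3, 4, 5, 6}"
      using assms(1-4) by auto
    then have "(\<Sum>q\<le>8. cnj (amp q1 RightEnd q) * amp q2 RightEnd q) = of_bool (q1 = q2)"
      by (rule amp_columns_RightEnd)
    then show ?thesis by (simp add: RightEnd iff)
  qed (use assms(5) in simp)
qed

lemma well_formed_rev_machine: "well_formed_on rev_machine w"
  unfolding well_formed_on_def
proof (intro ballI impI)
  let ?A = "attainable rev_machine w"
  let ?S = "step_amp rev_machine w 0"
  fix c1 c2
  assume c1: "c1 \<in> ?A" "fst (snd c1) < length (input_tape w)"
    and c2: "c2 \<in> ?A" "fst (snd c2) < length (input_tape w)"
  obtain q1 i1 m1 where e1: "c1 = (q1, i1, m1)" by (cases c1)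
  obtain q2 i2 m2 where e2: "c2 = (q2, i2, m2)" by (cases c2)
  have "(\<Sum>c\<in>?A. cnj (?S c c1) * ?S c c2) = (if c1 = c2 then 1 else 0)"
  proof (cases "i1 = i2")
    case False
    have "cnj (?S c c1) * ?S c c2 = 0" for c
      using False by (cases c) (simp add: e1 e2 step_amp_rev_machine)
    then have "(\<Sum>c\<in>?A. cnj (?S c c1) * ?S c c2) = 0"
      by (intro sum.neutral) blast
    then show ?thesis using False by (simp add: e1 e2)
  next
    case True
    note sum_eq = sum_step_amp[OF c1(1)[unfolded e1], of q2 m2]
    show ?thesis
    proof (cases "i1 = 0")
      case i0: True
      have "c1 = init_conf rev_machine"
        using c1 by (rule attainable_cases) (use i0 in \<open>auto simp: path_conf_def e1 split: prod.splits\<close>)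
      moreover have "c2 = init_conf rev_machine"
        using c2 by (rule attainable_cases) (use i0 True in \<open>auto simp: path_conf_def e2 split: prod.splits\<close>)
      moreover have "(\<Sum>q\<le>8. cnj (amp q1 LeftEnd q) * amp q2 LeftEnd q) = 1"
        by (simp add: numeral_eq_Suc)
      ultimately show ?thesis using sum_eq i0 True
        by (simp add: e1 e2 init_conf_rev_machine input_tape_nth)
    next
      case i0: False
      obtain j1 k1 where p1: "j1 \<in> {1, 2}" "k1 \<le> length w" "c1 = path_conf w j1 k1"
        using c1 by (rule attainable_cases) (use i0 in \<open>auto simp: init_conf_rev_machine e1\<close>)
      obtain j2 k2 where p2: "j2 \<in> {1, 2}" "k2 \<le> length w" "c2 = path_conf w j2 k2"
        using c2 by (rule attainable_cases) (use i0 True in \<open>auto simp: init_conf_rev_machine e2\<close>)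
      have k: "i1 = Suc k1" "k2 = k1"
        using p1(3) p2(3) True by (auto simp: path_conf_def e1 e2 split: prod.splits)
      have q: "q1 \<in> {j1, j1 + 2, j1 + 4}" "q2 \<in> {j2, j2 + 2, j2 + 4}"
        using p1(3) p2(3) fst_run[OF p1(1), of "take k1 w"] fst_run[OF p2(1), of "take k2 w"]
        by (auto simp: path_conf_def e1 e2 split: prod.splits)
      have iff: "c1 = c2 \<longleftrightarrow> j1 = j2"
      proof
        assume "c1 = c2"
        then have "q1 = q2" by (simp add: e1 e2)
        then show "j1 = j2" using p1(1) p2(1) q by auto
      qed (simp add: p1(3) p2(3) k)
      have "input_tape w ! i1 \<noteq> LeftEnd"
        using p1(2) k by (cases "k1 = length w") (auto simp: input_tape_nth)
      then have "(\<Sum>q\<le>8. cnj (amp q1 (input_tape w ! i1) q) * amp q2 (input_tape w ! i1) q)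
          = of_bool (j1 = j2)"
        using p1(1) p2(1) q iff by (intro amp_columns) (auto simp: e1 e2)
      \<comment> \<open>Different paths give 0 whether or not the updated memories agree; on the
        same path the configurations coincide, hence so do the memories.\<close>
      then show ?thesis using sum_eq c1(2) iff True by (auto simp: e1 e2)
    qed
  qed
  then show "(\<Sum>\<omega>\<in>register_alphabet rev_machine. \<Sum>c\<in>?A.
      cnj (step_amp rev_machine w \<omega> c c1) * step_amp rev_machine w \<omega> c c2) =
      (if c1 = c2 then 1 else 0)"
    by simp
qed

lemma is_rt_qfa_wom_rev_machine: "is_rt_qfa_wom rev_machine"
  by (auto simp: is_rt_qfa_wom_def well_formed_rev_machine)

section \<open>Pure-state evolution and the acceptance probability\<close>

text \<open>A single operation element \<open>E\<close> sends the projector of \<open>\<psi>\<close>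
  to that of \<open>E \<psi>\<close>, so vectors can replace density matrices.\<close>

lemma evolve_pure:
  assumes "register_alphabet M = {r}"
  shows "evolve M w (\<lambda>c c'. \<psi> c * cnj (\<psi> c')) =
    (\<lambda>c c'. (\<Sum>e\<in>attainable M w. step_amp M w r c e * \<psi> e) *
       cnj (\<Sum>e\<in>attainable M w. step_amp M w r c' e * \<psi> e))"
  by (intro ext) (simp add: evolve_def assms sum_product mult_ac)

definition path_state :: "letter list \<Rightarrow> nat \<Rightarrow> (nat, nat) configuration \<Rightarrow> complex" where
  "path_state w k c =
    half_amp * of_bool (c = path_conf w 1 k) + half_amp * of_bool (c = path_conf w 2 k)"

text \<open>With a row of the step matrix as \<open>f\<close>, this is one entry of the vector after
  the next step.\<close>

lemma sum_path_state:
  assumes "k \<le> length w"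
  shows "(\<Sum>e\<in>attainable rev_machine w. f e * path_state w k e) =
    half_amp * (f (path_conf w 1 k) + f (path_conf w 2 k))"
proof -
  have fin: "finite (attainable rev_machine w)" by (rule finite_attainable) simp_all
  have "(\<Sum>e\<in>attainable rev_machine w. f e * path_state w k e) =
    (\<Sum>e\<in>attainable rev_machine w. (if e = path_conf w 1 k then half_amp * f e else 0)
       + (if e = path_conf w 2 k then half_amp * f e else 0))"
    by (rule sum.cong) (auto simp: path_state_def algebra_simps)
  then show ?thesis
    using fin path_conf_attainable[of 1 k w] path_conf_attainable[of 2 k w] assms
    by (simp add: sum.distrib algebra_simps)
qed

text \<open>The extra step in \<open>Suc k\<close> is the split on the left end-marker.\<close>

lemma evolve_path_state:
  assumes "k \<le> length w"
  shows "(evolve rev_machine w ^^ Suc k) (init_density rev_machine) =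
    (\<lambda>c c'. path_state w k c * cnj (path_state w k c'))"
  using assms
proof (induction k)
  case 0
  have fin: "finite (attainable rev_machine w)" by (rule finite_attainable) simp_all
  let ?\<psi> = "\<lambda>c. of_bool (c = init_conf rev_machine) :: complex"
  have "init_density rev_machine = (\<lambda>c c'. ?\<psi> c * cnj (?\<psi> c'))"
    by (auto simp: init_density_def fun_eq_iff)
  moreover have "(\<Sum>e\<in>attainable rev_machine w. step_amp rev_machine w 0 c e * ?\<psi> e)
      = path_state w 0 c" for c
    using fin attainable.initial[of rev_machine w]
    by (simp add: of_bool_def if_distrib[where f = "\<lambda>x. _ * x"] step_amp_init path_state_def
        cong: if_cong)
  ultimately show ?case by (simp add: evolve_pure[where r = 0])
next
  case (Suc k)
  have "(\<Sum>e\<in>attainable rev_machine w. step_amp rev_machine w 0 c e * path_state w k e)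
      = path_state w (Suc k) c" for c
    unfolding sum_path_state[OF Suc_leD[OF Suc.prems]]
    using Suc.prems by (simp add: step_amp_path_conf path_state_def distrib_left)
  then show ?case using Suc by (simp add: evolve_pure[where r = 0])
qed

text \<open>From states 3 and 4 each path reaches state 7 with amplitude \<open>1 / 2\<close>. Equal
  memories add up to amplitude 1, different ones give \<open>1 / 4 + 1 / 4\<close>. From all other
  states of the paths, state 7 is out of reach.\<close>

lemma accept_prob_rev_machine:
  "accept_prob rev_machine w =
    (if fst (run 1 w) = 3 then if snd (run 1 w) = snd (run 2 w) then 1 else 1 / 2 else 0)"
proof -
  let ?A = "attainable rev_machine w"
  let ?n = "length w"
  obtain q1 m1 where r1: "run 1 w = (q1, m1)" by (meson surj_pair)
  obtain q2 m2 where r2: "run 2 w = (q2, m2)" by (meson surj_pair)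
  have q1: "q1 \<in> {1, 3, 5}" and q2: "q2 = Suc q1"
    using fst_run[of 1 w] fst_run_Suc[of w] r1 r2 by auto
  \<comment> \<open>\<open>F m\<close> is the accepting configuration with memory \<open>m\<close>
    after the whole tape, markers included, has been read.\<close>
  define F where "F m = (7::nat, Suc (Suc ?n), m :: (int \<Rightarrow> nat) \<times> int)" for m
  have p: "path_conf w 1 ?n = (q1, Suc ?n, m1)" "path_conf w 2 ?n = (q2, Suc ?n, m2)"
    using r1 r2 by (simp_all add: path_conf_def)
  have amps: "step_amp rev_machine w 0 c (path_conf w 1 ?n) =
        half_amp * of_bool (q1 = 3 \<and> c = F m1)"
      "step_amp rev_machine w 0 c (path_conf w 2 ?n) =
        half_amp * of_bool (q1 = 3 \<and> c = F m2)" if "fst c = 7" for c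
  proof -
    obtain i m where c: "c = (7, i, m)" using \<open>fst c = 7\<close> by (cases c) auto
    show "step_amp rev_machine w 0 c (path_conf w 1 ?n) = half_amp * of_bool (q1 = 3 \<and> c = F m1)"
      using q1 unfolding p c step_amp_rev_machine F_def by (auto simp: input_tape_nth)
    show "step_amp rev_machine w 0 c (path_conf w 2 ?n) = half_amp * of_bool (q1 = 3 \<and> c = F m2)"
      using q1 unfolding p c step_amp_rev_machine F_def q2 by (auto simp: input_tape_nth)
  qed
  have attF: "F m1 \<in> ?A" "F m2 \<in> ?A" if "q1 = 3"
  proof -
    show "F m1 \<in> ?A"
      by (rule attainable.step[OF path_conf_attainable[of 1 ?n], where \<omega> = 0])
        (use amps(1)[of "F m1"] that in \<open>auto simp: F_def\<close>)
    show "F m2 \<in> ?A"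
      by (rule attainable.step[OF path_conf_attainable[of 2 ?n], where \<omega> = 0])
        (use amps(2)[of "F m2"] that in \<open>auto simp: F_def\<close>)
  qed
  let ?\<phi> = "\<lambda>c. half_amp * (step_amp rev_machine w 0 c (path_conf w 1 ?n) +
                step_amp rev_machine w 0 c (path_conf w 2 ?n))"
  have dens: "final_density rev_machine w = (\<lambda>c c'. ?\<phi> c * cnj (?\<phi> c'))"
    using evolve_path_state[of ?n w]
    by (simp add: final_density_def evolve_pure[where r = 0] sum_path_state)
  define B where "B = {c \<in> ?A. fst c = 7}"
  have finB: "finite B" unfolding B_def
    by (rule finite_subset[OF _ finite_attainable]) auto
  have \<phi>: "?\<phi> c = complex_of_real ((of_bool (q1 = 3 \<and> c = F m1) + of_bool (q1 = 3 \<and> c = F m2)) / 2)" if "c \<in> B" for c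
  proof -
    have "fst c = 7" using that by (simp add: B_def)
    then show ?thesis
      unfolding amps[OF \<open>fst c = 7\<close>] by (simp add: distrib_left flip: mult.assoc)
  qed
  have "Re (final_density rev_machine w c c) =
      (of_bool (q1 = 3 \<and> c = F m1) + of_bool (q1 = 3 \<and> c = F m2))\<^sup>2 / 4" if "c \<in> B" for c
    unfolding dens \<phi>[OF that] by (simp add: power2_eq_square)
  then have acc: "accept_prob rev_machine w =
      (\<Sum>c\<in>B. (of_bool (q1 = 3 \<and> c = F m1) + of_bool (q1 = 3 \<and> c = F m2))\<^sup>2 / 4)"
    unfolding accept_prob_def by (intro sum.cong) (simp_all add: B_def)
  show ?thesis
  proof (cases "q1 = 3")
    case False
    then show ?thesis using r1 by (simp add: acc)
  next
    case True
    have inB: "F m1 \<in> B" "F m2 \<in> B" using attF[OF True] by (auto simp: B_def F_def)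
    have eq: "F m1 = F m2 \<longleftrightarrow> m1 = m2" by (simp add: F_def)
    \<comment> \<open>If \<open>m1 = m2\<close>, the full weight 1 is assigned to the first
      indicator and 0 to the second, so one formula covers both cases.\<close>
    have "(\<Sum>c\<in>B. (of_bool (q1 = 3 \<and> c = F m1) + of_bool (q1 = 3 \<and> c = F m2))\<^sup>2 / 4)
       = (\<Sum>c\<in>B. (if c = F m1 then (if m1 = m2 then 1 else 1 / 4) else 0)
            + (if c = F m2 then (if m1 = m2 then 0 else 1 / 4) else (0::real)))"
      by (rule sum.cong) (use True eq in auto)
    also have "\<dots> = (if m1 = m2 then 1 else 1 / 2)"
      using finB inB by (simp add: sum.distrib)
    finally show ?thesis using True r1 r2 by (simp add: acc)
  qed
qed

section \<open>Memory contents and the language\<close>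

definition first_tape :: "letter list \<Rightarrow> int \<Rightarrow> nat" where
  "first_tape u = (\<lambda>x. if 0 \<le> x \<and> x < int (length u) then code (u ! nat x) else 0)"

text \<open>Here \<open>n\<close> is the length of the prefix before \<open>Lc\<close>. Writing
  starts at square \<open>n - 1\<close> and goes left, into negative squares if \<open>v\<close> is
  longer than the prefix.\<close>

definition second_tape :: "nat \<Rightarrow> letter list \<Rightarrow> int \<Rightarrow> nat" where
  "second_tape n v = (\<lambda>x. if int n - int (length v) \<le> x \<and> x < int n
     then code (v ! nat (int n - 1 - x)) else 0)"

lemma code_eq_1_iff: "code x = 1 \<longleftrightarrow> x = Lc"
  by (cases x) auto

lemma run_before:
  assumes "Lc \<notin> set u"
  shows "run 1 u = (1, first_tape u, int (length u))" "run 2 u = (2, \<lambda>_. 0, int (length u))"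
proof -
  have "run 1 u = (1, first_tape u, int (length u)) \<and> run 2 u = (2, \<lambda>_. 0, int (length u))"
    using assms
  proof (induction u rule: rev_induct)
    case Nil
    then show ?case by (auto simp: run_def first_tape_def)
  next
    case (snoc x u)
    have "first_tape (u @ [x]) = (first_tape u)(int (length u) := code x)"
      by (auto simp: first_tape_def fun_eq_iff nth_append)
    with snoc show ?case
      using code_eq_1_iff[of x] by (auto simp: run_snoc update_def)
  qed
  then show "run 1 u = (1, first_tape u, int (length u))"
    "run 2 u = (2, \<lambda>_. 0, int (length u))" by auto
qed

text \<open>The \<open>- 1\<close> is the turn made on \<open>Lc\<close>. The heads coincide, so
  only the tapes decide whether the memories agree.\<close>

lemma run_after:
  assumes "Lc \<notin> set u" "Lc \<notin> set v"
  shows "run 1 (u @ Lc # v) = (3, first_tape u, int (length u) - int (length v) - 1) \<and>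
    run 2 (u @ Lc # v) = (4, second_tape (length u) v, int (length u) - int (length v) - 1)"
  using assms(2)
proof (induction v rule: rev_induct)
  case Nil
  have "second_tape (length u) [] = (\<lambda>_. 0)" by (auto simp: second_tape_def)
  then show ?case using run_before[OF assms(1)]
    by (simp add: run_snoc update_def)
next
  case (snoc x v)
  have "second_tape (length u) (v @ [x]) =
      (second_tape (length u) v)(int (length u) - int (length v) - 1 := code x)"
    by (auto simp: second_tape_def fun_eq_iff nth_append)
  moreover have "u @ Lc # v @ [x] = (u @ Lc # v) @ [x]" by simp
  ultimately show ?case using snoc code_eq_1_iff[of x]
    unfolding \<open>u @ Lc # v @ [x] = (u @ Lc # v) @ [x]\<close> run_snoc
    by (auto simp: update_def)
qed

text \<open>No code is blank, so the written squares force equal lengths; injectivity of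
  \<open>code\<close> then compares the letters of \<open>u\<close> with those of \<open>v\<close>
  in reverse order.\<close>

lemma tapes_eq_iff: "first_tape u = second_tape (length u) v \<longleftrightarrow> v = rev u"
proof
  have pos: "code x \<noteq> 0" for x by (cases x) auto
  have inj: "code x = code y \<Longrightarrow> x = y" for x y by (cases x; cases y) auto
  assume eq: "first_tape u = second_tape (length u) v"
  have len: "length v = length u"
  proof (rule ccontr)
    assume "length v \<noteq> length u"
    \<comment> \<open>If \<open>v\<close> is too short, square 0 is written on the first tape only;
      if it is too long, square \<open>-1\<close> is written on the second only.\<close>
    then consider "length v < length u" | "length u < length v" by linarith
    then show False
    proof cases
      case 1
      then show False using fun_cong[OF eq, of 0] pos[of "u ! 0"]
        by (simp add: first_tape_def second_tape_def split: if_splits)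
    next
      case 2
      then show False using fun_cong[OF eq, of "-1"] pos by (auto simp: first_tape_def second_tape_def)
    qed
  qed
  show "v = rev u"
  proof (rule nth_equalityI)
    fix i assume i: "i < length v"
    let ?k = "length u - Suc i"
    have k: "int ?k = int (length u) - 1 - int i"
      and k': "nat (int (length u) - 1 - int i) = ?k" using i len by simp_all
    have "code (u ! ?k) = code (v ! i)"
      using fun_cong[OF eq, of "int ?k"] i len
      by (simp add: first_tape_def second_tape_def k k')
    then show "v ! i = rev u ! i" using inj i len by (simp add: rev_nth)
  qed (simp add: len)
next
  assume v: "v = rev u"
  show "first_tape u = second_tape (length u) v"
  proof
    fix x
    show "first_tape u x = second_tape (length u) v x"
    proof (cases "0 \<le> x \<and> x < int (length u)")
      case True
      then obtain k where k: "x = int k" "k < length u"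
        by (metis nonneg_int_cases of_nat_less_iff)
      then have "nat (int (length u) - 1 - x) = length u - Suc k" by simp
      then show ?thesis using k by (simp add: v first_tape_def second_tape_def rev_nth)
    next
      case False
      then show ?thesis by (auto simp: v first_tape_def second_tape_def)
    qed
  qed
qed

text \<open>Once the second \<open>Lc\<close> has led to state 5, no letter leads out of it.\<close>

lemma fst_run_append_ge5: "fst (run 1 xs) \<ge> 5 \<Longrightarrow> fst (run 1 (xs @ ys)) \<ge> 5"
proof (induction ys rule: rev_induct)
  case (snoc y ys)
  then show ?case
    by (cases "run 1 (xs @ ys)") (simp add: run_snoc flip: append_assoc)
qed simp

lemma mem_L_rev_iff: "w \<in> L_rev \<longleftrightarrow> (\<exists>u. Lc \<notin> set u \<and> w = u @ Lc # rev u)"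
proof -
  have "u \<in> lists {La, Lb} \<longleftrightarrow> Lc \<notin> set u" for u
    by (auto simp: in_lists_conv_set) (metis letter.exhaust)
  then show ?thesis by (auto simp: L_rev_def)
qed

text \<open>State 3 at the end means exactly one \<open>Lc\<close>; then equality of the memories is
  the condition on the two tapes.\<close>

lemma run_characterizes_L_rev:
  "fst (run 1 w) = 3 \<and> snd (run 1 w) = snd (run 2 w) \<longleftrightarrow> w \<in> L_rev"
proof
  assume r: "fst (run 1 w) = 3 \<and> snd (run 1 w) = snd (run 2 w)"
  then have "Lc \<in> set w" using run_before(1)[of w] by (cases "Lc \<in> set w") auto
  then obtain u v where w: "w = u @ Lc # v" and u: "Lc \<notin> set u"
    by (metis split_list_first)
  have v: "Lc \<notin> set v"
  proof
    assume "Lc \<in> set v"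
    then obtain v1 v2 where v: "v = v1 @ Lc # v2" and "Lc \<notin> set v1"
      by (metis split_list_first)
    then have "fst (run 1 ((u @ Lc # v1) @ [Lc])) \<ge> 5"
      unfolding run_snoc using run_after[OF u, of v1] by simp
    then have "fst (run 1 (((u @ Lc # v1) @ [Lc]) @ v2)) \<ge> 5"
      by (rule fst_run_append_ge5)
    with r show False by (simp add: w v)
  qed
  have "first_tape u = second_tape (length u) v"
    using r run_after[OF u v] by (simp add: w)
  then show "w \<in> L_rev" using u w by (auto simp: tapes_eq_iff mem_L_rev_iff)
next
  assume "w \<in> L_rev"
  then obtain u where u: "Lc \<notin> set u" "w = u @ Lc # rev u" by (auto simp: mem_L_rev_iff)
  then show "fst (run 1 w) = 3 \<and> snd (run 1 w) = snd (run 2 w)"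
    using run_after[of u "rev u"] tapes_eq_iff[of u "rev u"] by simp
qed

theorem theorem6:
  shows "\<exists>M :: (nat, letter, nat, nat) rt_qfa_wom.
    is_rt_qfa_wom M \<and> input_alphabet M = {La, Lb, Lc} \<and>
    recognizes_neg_one_sided M L_rev (1 / 2)"
proof (intro exI conjI)
  have "w \<in> lists {La, Lb, Lc}" for w
    by (auto simp: in_lists_conv_set) (metis letter.exhaust)
  moreover have "accept_prob rev_machine w = 1" if "w \<in> L_rev" for w
    using that run_characterizes_L_rev[of w] by (simp add: accept_prob_rev_machine)
  moreover have "accept_prob rev_machine w \<le> 1 / 2" if "w \<notin> L_rev" for w
    using that run_characterizes_L_rev[of w] by (auto simp: accept_prob_rev_machine)
  ultimately show "recognizes_neg_one_sided rev_machine L_rev (1 / 2)"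
    by (auto simp: recognizes_neg_one_sided_def)
qed (simp_all add: is_rt_qfa_wom_rev_machine)

end
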